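(* Let $X$ be a universal set and let $A,B\in\mathbb F(X)$ satisfy $A,B\neq\emptyset$, $0\le\mu_A(x)\mu_B(x)\le1/4$ and $0<\mu_A(x)+\mu_B(x)\le1$ for any $x\in X$. Then $$\frac{A\oplus B}{4}\supseteq\frac{\sqrt{A\cdot B}}{2}\supseteq (A\cdot B)\oslash(A\oplus B).$$ Both of the equalities hold if and only if $A=B$.
   Context: A fuzzy set $A$ on a universal set $X$ is given by its membership function $\mu_A:X\to[0,1]$; $\mathbb F(X)$ is the set of fuzzy sets on $X$. $A\subseteq B$ (equivalently $B\supseteq A$) means $\mu_A(x)\le\mu_B(x)$ for all $x\in X$; $A=B$ means $\mu_A(x)=\mu_B(x)$ for all $x\in X$. $\emptyset$ denotes the fuzzy set whose membership function is identically $0$. Bounded sum: $\mu_{A\oplus B}(x)=\min\{\mu_A(x)+\mu_B(x),1\}$. Algebraic product: $\mu_{A\cdot B}(x)=\mu_A(x)\mu_B(x)$. Bounded quotient (for $B\neq\emptyset$): $\mu_{A\oslash B}(x)=\min\{\mu_A(x)/\mu_B(x),1\}$. Scalar multiplication for real $0\le\kappa\le1$: $\mu_{\kappa A}(x)=\kappa\mu_A(x)$; $\frac{A}{2}$ and $\frac{A}{4}$ mean $\frac12A$ and $\frac14A$. Powers for real $p\ge0$: $\mu_{A^p}(x)=\mu_A(x)^p$; $\sqrt A$ means $A^{1/2}$. *)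

theory Defs
  imports Complex_Main
begin

text \<open>
  The universal set is the type \<open>'a\<close>. A fuzzy set is identified with its membership
  function; the bound \<open>0 \<le> \<mu>\<^sub>A(x) \<le> 1\<close> is membership in \<open>fuzzy_sets\<close>. Hence equality of
  fuzzy sets is equality of functions.
\<close>

type_synonym 'a fuzzy = "'a \<Rightarrow> real"

definition fuzzy_sets :: "'a fuzzy set"
  where "fuzzy_sets = {A. \<forall>x. A x \<in> {0..1}}"

definition fuzzy_empty :: "'a fuzzy"  ("\<emptyset>\<^sub>F")
  where "\<emptyset>\<^sub>F = (\<lambda>x. 0)"

definition fuzzy_subset :: "'a fuzzy \<Rightarrow> 'a fuzzy \<Rightarrow> bool"  (infix "\<subseteq>\<^sub>F" 50)
  where "A \<subseteq>\<^sub>F B \<longleftrightarrow> (\<forall>x. A x \<le> B x)"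

abbreviation fuzzy_supset :: "'a fuzzy \<Rightarrow> 'a fuzzy \<Rightarrow> bool"  (infix "\<supseteq>\<^sub>F" 50)
  where "A \<supseteq>\<^sub>F B \<equiv> B \<subseteq>\<^sub>F A"

definition bounded_sum :: "'a fuzzy \<Rightarrow> 'a fuzzy \<Rightarrow> 'a fuzzy"  (infixl "\<oplus>\<^sub>F" 65)
  where "A \<oplus>\<^sub>F B = (\<lambda>x. min (A x + B x) 1)"

definition algebraic_product :: "'a fuzzy \<Rightarrow> 'a fuzzy \<Rightarrow> 'a fuzzy"  (infixl "\<cdot>\<^sub>F" 70)
  where "A \<cdot>\<^sub>F B = (\<lambda>x. A x * B x)"

text \<open>
  Meaningful only where \<open>B x \<noteq> 0\<close>; elsewhere the HOL convention \<open>a / 0 = 0\<close> applies.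
\<close>

definition bounded_quotient :: "'a fuzzy \<Rightarrow> 'a fuzzy \<Rightarrow> 'a fuzzy"  (infixl "\<oslash>\<^sub>F" 70)
  where "A \<oslash>\<^sub>F B = (\<lambda>x. min (A x / B x) 1)"

definition fuzzy_scale :: "real \<Rightarrow> 'a fuzzy \<Rightarrow> 'a fuzzy"  (infixr "*\<^sub>F" 75)
  where "\<kappa> *\<^sub>F A = (\<lambda>x. \<kappa> * A x)"

text \<open>
  The case \<open>p = 0\<close> is separate because \<open>0 powr 0 = 0\<close> in HOL, whereas \<open>0\<^sup>0 = 1\<close> is intended.
\<close>

definition fuzzy_power :: "'a fuzzy \<Rightarrow> real \<Rightarrow> 'a fuzzy"  (infixr "^\<^sub>F" 80)
  where "A ^\<^sub>F p = (\<lambda>x. if p = 0 then 1 else A x powr p)"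

definition fuzzy_sqrt :: "'a fuzzy \<Rightarrow> 'a fuzzy"
  where "fuzzy_sqrt A = A ^\<^sub>F (1/2)"

lemma fuzzy_sets_closed:
  assumes "A \<in> fuzzy_sets" "B \<in> fuzzy_sets"
  shows "A \<oplus>\<^sub>F B \<in> fuzzy_sets"
    and "A \<cdot>\<^sub>F B \<in> fuzzy_sets"
    and "A \<oslash>\<^sub>F B \<in> fuzzy_sets"
    and "0 \<le> \<kappa> \<Longrightarrow> \<kappa> \<le> 1 \<Longrightarrow> \<kappa> *\<^sub>F A \<in> fuzzy_sets"
    and "0 \<le> p \<Longrightarrow> A ^\<^sub>F p \<in> fuzzy_sets"
  using assms
  by (auto simp: fuzzy_sets_def bounded_sum_def algebraic_product_def bounded_quotient_def
      fuzzy_scale_def fuzzy_power_def mult_le_one powr_le1)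

end

theory Submission
  imports Defs
begin

text \<open>Everything is pointwise. For a = \<open>A x\<close>, b = \<open>B x\<close> and s = sqrt
  (a * b), both inclusions are the AM-GM inequality 2 * s \<le> a + b: divided by 4 it is the first
  (\<open>sqrt_mult_le_half_sum\<close>), multiplied by s / (2 * (a + b)) it is the second
  (\<open>mult_div_sum_le_half_sqrt\<close>). The equality case rests on the first inclusion, where
  equality forces a = b (\<open>sqrt_mult_eq_half_sum_iff\<close>); the second is also an equality
  wherever s = 0. If a = b, all three terms are a / 2.\<close>

lemma sqrt_mult_le_half_sum:
  fixes a b :: real
  assumes "0 \<le> a" "0 \<le> b"
  shows "sqrt (a * b) / 2 \<le> (a + b) / 4"
  using arith_geo_mean_sqrt[OF assms] by simp

text \<open>The equality case of AM-GM: squaring gives (a + b)^2 = 4 * a * b, which says that (a -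
  b)^2 vanishes.\<close>

lemma sqrt_mult_eq_half_sum_iff:
  fixes a b :: real
  assumes "0 \<le> a" "0 \<le> b"
  shows "(a + b) / 4 = sqrt (a * b) / 2 \<longleftrightarrow> a = b"
proof
  assume "(a + b) / 4 = sqrt (a * b) / 2"
  then have "a + b = 2 * sqrt (a * b)"
    by simp
  then have "(a + b)\<^sup>2 = (2 * sqrt (a * b))\<^sup>2"
    by (rule arg_cong)
  then have "(a + b)\<^sup>2 = 4 * (a * b)"
    using assms by (simp add: power_mult_distrib)
  then have "(a - b)\<^sup>2 = 0"
    by (simp add: power2_eq_square algebra_simps)
  then show "a = b"
    by simp
qed (use assms in simp)

text \<open>With \<open>s = sqrt (a * b)\<close> this is \<open>s\<^sup>2 / (a + b) \<le> s / 2\<close>, that is \<open>2 * s \<le> a + b\<close> again.\<close>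

lemma mult_div_sum_le_half_sqrt:
  fixes a b :: real
  assumes "0 \<le> a" "0 \<le> b" "0 < a + b"
  shows "a * b / (a + b) \<le> sqrt (a * b) / 2"
proof -
  have "sqrt (a * b) * (2 * sqrt (a * b)) \<le> sqrt (a * b) * (a + b)"
    using sqrt_mult_le_half_sum[OF assms(1,2)] assms by (intro mult_left_mono) auto
  moreover have "sqrt (a * b) * sqrt (a * b) = a * b"
    using assms by simp
  ultimately have "a * b \<le> sqrt (a * b) / 2 * (a + b)"
    by (simp add: field_simps)
  then show ?thesis
    using assms(3) by (simp only: pos_divide_le_eq)
qed

theorem corollary2p1:
  fixes A B :: "'a fuzzy"
  assumes "A \<in> fuzzy_sets" and "B \<in> fuzzy_sets"
    and "A \<noteq> \<emptyset>\<^sub>F" and "B \<noteq> \<emptyset>\<^sub>F"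
    and "\<forall>x. 0 \<le> A x * B x \<and> A x * B x \<le> 1/4"
    and "\<forall>x. 0 < A x + B x \<and> A x + B x \<le> 1"
  shows "(1/4) *\<^sub>F (A \<oplus>\<^sub>F B) \<supseteq>\<^sub>F (1/2) *\<^sub>F fuzzy_sqrt (A \<cdot>\<^sub>F B)
    \<and> (1/2) *\<^sub>F fuzzy_sqrt (A \<cdot>\<^sub>F B) \<supseteq>\<^sub>F (A \<cdot>\<^sub>F B) \<oslash>\<^sub>F (A \<oplus>\<^sub>F B)
    \<and> ((1/4) *\<^sub>F (A \<oplus>\<^sub>F B) = (1/2) *\<^sub>F fuzzy_sqrt (A \<cdot>\<^sub>F B)
        \<and> (1/2) *\<^sub>F fuzzy_sqrt (A \<cdot>\<^sub>F B) = (A \<cdot>\<^sub>F B) \<oslash>\<^sub>F (A \<oplus>\<^sub>F B)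
        \<longleftrightarrow> A = B)"
proof -
  have nonneg: "0 \<le> A x" "0 \<le> B x" for x
    using assms(1,2) by (auto simp: fuzzy_sets_def)
  have pos: "0 < A x + B x" and le1: "A x + B x \<le> 1" for x
    using assms(6) by auto
  \<comment> \<open>Since \<open>A x + B x\<close> is at most 1, the truncation in the bounded sum
    is inactive.\<close>
  have lhs: "(1/4) *\<^sub>F (A \<oplus>\<^sub>F B) = (\<lambda>x. (A x + B x) / 4)"
    using le1 by (simp add: fuzzy_scale_def bounded_sum_def)
  have mid: "(1/2) *\<^sub>F fuzzy_sqrt (A \<cdot>\<^sub>F B) = (\<lambda>x. sqrt (A x * B x) / 2)"
    using nonneg
    by (simp add: fuzzy_scale_def fuzzy_sqrt_def fuzzy_power_def algebraic_product_def
        powr_half_sqrt)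
  have quot_le: "A x * B x / (A x + B x) \<le> sqrt (A x * B x) / 2" for x
    by (rule mult_div_sum_le_half_sqrt[OF nonneg pos])
  \<comment> \<open>The truncation in the bounded quotient is inactive too, because the two
    inequalities chained bound the quotient by a quarter of the sum.\<close>
  have "A x * B x / (A x + B x) \<le> 1" for x
  proof -
    note quot_le
    also have "sqrt (A x * B x) / 2 \<le> (A x + B x) / 4"
      by (rule sqrt_mult_le_half_sum[OF nonneg])
    also have "\<dots> \<le> 1"
      using le1[of x] by simp
    finally show ?thesis .
  qed
  then have rhs: "(A \<cdot>\<^sub>F B) \<oslash>\<^sub>F (A \<oplus>\<^sub>F B) = (\<lambda>x. A x * B x / (A x + B x))"
    using le1 by (simp add: bounded_quotient_def algebraic_product_def bounded_sum_def)
  have "(A x + B x) / 4 = sqrt (A x * B x) / 2 \<longleftrightarrow> A x = B x" for x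
    by (rule sqrt_mult_eq_half_sum_iff[OF nonneg])
  then have eq_iff: "(\<lambda>x. (A x + B x) / 4) = (\<lambda>x. sqrt (A x * B x) / 2) \<longleftrightarrow> A = B"
    by (simp add: fun_eq_iff)
  \<comment> \<open>This gives the second equality when \<open>A = B\<close>; the converse comes
    from the first equality alone, through \<open>eq_iff\<close>.\<close>
  have "sqrt (A x * B x) / 2 = A x * B x / (A x + B x)" if "A = B" for x
    using that nonneg[of x] by simp
  then show ?thesis
    unfolding lhs mid rhs eq_iff fuzzy_subset_def
    using quot_le sqrt_mult_le_half_sum[OF nonneg] by blast
qed

end
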